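(* Let $S=\{1,2,\ldots,N\}$ with $N\in\mathbb{N}$, and let $M$ be the Markov transition matrix of a discrete-time multiple coupon collection process (MCCP) for $S$, that is, a CM matrix with parameter vector $p=(p_K)_{K\subseteq S}$. The matrix $M$ is non-singular if and only if $p_\varnothing>0$. If $M$ is non-singular, then: (1) $M$ has a real logarithm $R$ (so $M=\mathrm{e}^R$), given by the principal matrix logarithm of $M$. (2) This $R$ is a triangular matrix (that is, $R_{IJ}=0$ whenever $I\not\subseteq J$) with zero row sums and real spectrum. It is a CG matrix, and its parameter vector $r=(r_K)_{K\subseteq S}$ is given by $r_\varnothing=\log(p_\varnothing)$ and, for $\varnothing\neq K\subseteq S$, $$ r_K \,=\, (-1)^{|K|}\sum_{\mathcal{A}\in\mathcal{P}(K)}(-1)^{|\mathcal{A}|-1}\bigl(|\mathcal{A}|-1\bigr)!\,\log\bigl(q^{\overline{K}}_{\mathcal{A}}\bigr). $$ (3) $R$ is a Markov generator if and only if $r_K\geqslant 0$ for all $\varnothing\neq K\subseteq S$, in which case $M$ is embeddable into a continuous-time MCCP. (4) $R$ is the only real matrix logarithm of $M$ that is a CG matrix. (5) If the spectrum of $M$ is simple (all eigenvalues distinct), no other real logarithm of $M$ exists, and $M$ is embeddable if and only if $R$ is a Markov generator.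
   Context: All matrices are real, of size $d\times d$ with $d=2^{N}$, with rows and columns indexed by the subsets of $S=\{1,\ldots,N\}$. Empty sums are zero. $\overline{K}=S\setminus K$ denotes the complement of $K$ in $S$, and $|K|$ the cardinality of $K$. CM matrix: $M$ is a CM matrix (has Property CM) if there is a probability vector $p=(p_K)_{K\subseteq S}$ (all $p_K\geqslant 0$, $\sum_{K\subseteq S}p_K=1$), called its parameter vector, such that $M_{IJ}=\sum_{K\subseteq S:\, I\cup K=J}p_K$ for all $I,J\subseteq S$. These are precisely the transition matrices of the discrete-time MCCP: in each step a random subset $Z\subseteq S$ with $\mathbb{P}(Z=K)=p_K$ is drawn, independently of everything else, and the current state $X_n\subseteq S$ is replaced by $X_{n+1}=X_n\cup Z$. CG matrix: $B$ is a CG matrix (has Property CG) if there is a real vector $r=(r_K)_{K\subseteq S}$ with $\sum_{K\subseteq S}r_K=0$, called its parameter vector, such that $B_{IJ}=\sum_{K\subseteq S:\, I\cup K=J}r_K$ for all $I,J\subseteq S$. A Markov generator (or rate matrix) is a real square matrix with non-negative off-diagonal entries and zero row sums. $M$ is embeddable if $M=\mathrm{e}^{Q}$ for some Markov generator $Q$ (that is, $M$ occurs in the Markov semigroup $\{\mathrm{e}^{tQ}:t\geqslant 0\}$ at time $1$); it is embeddable into a continuous-time MCCP if such a $Q$ can be chosen to be a CG matrix. A real logarithm of $M$ is a real matrix $R$ with $M=\mathrm{e}^R$. Avoidance probabilities: for $K\subseteq S$, $q_K=\mathbb{P}(Z\cap K=\varnothing)=\sum_{I\subseteq\overline{K}}p_I$.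 If $p_\varnothing>0$, all $q_K>0$, and for $A,B\subseteq S$ one sets $q^{B}_{A}=\mathbb{P}(Z\cap A=\varnothing\mid Z\cap B=\varnothing)=q_{A\cup B}/q_B$. $\mathcal{P}(K)$ is the set of all partitions $\mathcal{A}$ of the non-empty set $K$ into non-empty blocks, $|\mathcal{A}|$ is the number of blocks of $\mathcal{A}$, and $q^{B}_{\mathcal{A}}=\prod_{A\in\mathcal{A}}q^{B}_{A}$ for $\mathcal A\in\mathcal P(K)$. *)

theory Defs
  imports "HOL-Analysis.Analysis" "HOL-Library.Disjoint_Sets"
begin

text \<open>
  The ground set \<open>S = {1, \<dots>, N}\<close> is rendered as the universe of a finite type \<open>'n\<close> with
  \<open>N = CARD('n)\<close>, so that the matrices indexed by the subsets of \<open>S\<close> have the type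
  \<open>real^('n set)^('n set)\<close> and the complement of \<open>K\<close> in \<open>S\<close> is \<open>- K\<close>.
\<close>

section \<open>Matrix exponential, spectrum and logarithm\<close>

definition mexp :: "'a::real_normed_field^'m^'m \<Rightarrow> 'a^'m^'m" where
  "mexp A = (\<Sum>n. (1 / fact n) *\<^sub>R (((**) A ^^ n) (mat 1)))"

abbreviation cmat :: "real^'m^'m \<Rightarrow> complex^'m^'m" where
  "cmat A \<equiv> map_matrix complex_of_real A"

definition spectrum :: "'a::field^'m^'m \<Rightarrow> 'a set" where
  "spectrum A = {\<mu>. \<exists>v. v \<noteq> 0 \<and> A *v v = \<mu> *s v}"

text \<open>A complex \<open>d \<times> d\<close> matrix has simple spectrum if its \<open>d\<close> eigenvalues are distinct.\<close>

definition simple_spectrum :: "complex^'m^'m \<Rightarrow> bool" where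
  "simple_spectrum A \<longleftrightarrow> card (spectrum A) = CARD('m)"

text \<open>
  The principal logarithm of \<open>A\<close> is the logarithm all of whose eigenvalues lie in the open strip
  \<open>-\<pi> < Im \<mu> < \<pi>\<close> (Higham, Functions of Matrices, Theorem 1.31). Such a logarithm can exist
  only if \<open>A\<close> has no eigenvalue on the closed negative real axis.
\<close>

definition is_principal_log :: "complex^'m^'m \<Rightarrow> complex^'m^'m \<Rightarrow> bool" where
  "is_principal_log A X \<longleftrightarrow> mexp X = A \<and> (\<forall>\<mu>\<in>spectrum X. - pi < Im \<mu> \<and> Im \<mu> < pi)"

section \<open>CM and CG matrices, Markov generators, embeddability\<close>

definition union_matrix :: "('n::finite set \<Rightarrow> real) \<Rightarrow> real^('n set)^('n set)" where
  "union_matrix p = (\<chi> I J. \<Sum>K | I \<union> K = J. p K)"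

definition CM_param :: "('n::finite set \<Rightarrow> real) \<Rightarrow> real^('n set)^('n set) \<Rightarrow> bool" where
  "CM_param p M \<longleftrightarrow> (\<forall>K. 0 \<le> p K) \<and> (\<Sum>K\<in>UNIV. p K) = 1 \<and> M = union_matrix p"

definition CG_param :: "('n::finite set \<Rightarrow> real) \<Rightarrow> real^('n set)^('n set) \<Rightarrow> bool" where
  "CG_param r B \<longleftrightarrow> (\<Sum>K\<in>UNIV. r K) = 0 \<and> B = union_matrix r"

definition CG_matrix :: "real^('n::finite set)^('n set) \<Rightarrow> bool" where
  "CG_matrix B \<longleftrightarrow> (\<exists>r. CG_param r B)"

definition zero_row_sums :: "real^'m^'m \<Rightarrow> bool" where
  "zero_row_sums Q \<longleftrightarrow> (\<forall>i. (\<Sum>j\<in>UNIV. Q $ i $ j) = 0)"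

definition markov_generator :: "real^'m^'m \<Rightarrow> bool" where
  "markov_generator Q \<longleftrightarrow> (\<forall>i j. i \<noteq> j \<longrightarrow> 0 \<le> Q $ i $ j) \<and> zero_row_sums Q"

definition embeddable :: "real^'m^'m \<Rightarrow> bool" where
  "embeddable M \<longleftrightarrow> (\<exists>Q. markov_generator Q \<and> M = mexp Q)"

definition MCCP_embeddable :: "real^('n::finite set)^('n set) \<Rightarrow> bool" where
  "MCCP_embeddable M \<longleftrightarrow> (\<exists>Q. markov_generator Q \<and> CG_matrix Q \<and> M = mexp Q)"

section \<open>Avoidance probabilities\<close>

definition avoid :: "('n::finite set \<Rightarrow> real) \<Rightarrow> 'n set \<Rightarrow> real" where
  "avoid p K = (\<Sum>I | I \<subseteq> - K. p I)"

text \<open>\<open>cond_avoid p B A\<close> and \<open>part_avoid p B \<A>\<close> are \<open>q\<close> with superscript \<open>B\<close> and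
  subscript \<open>A\<close> and \<open>\<A>\<close>, respectively.\<close>

definition cond_avoid :: "('n::finite set \<Rightarrow> real) \<Rightarrow> 'n set \<Rightarrow> 'n set \<Rightarrow> real" where
  "cond_avoid p B A = avoid p (A \<union> B) / avoid p B"

definition part_avoid :: "('n::finite set \<Rightarrow> real) \<Rightarrow> 'n set \<Rightarrow> 'n set set \<Rightarrow> real" where
  "part_avoid p B \<A> = (\<Prod>A\<in>\<A>. cond_avoid p B A)"

end

theory Submission
  imports Defs "HOL-Computational_Algebra.Fundamental_Theorem_Algebra"
begin

text \<open>
  The indicator vectors \<open>zeta_vec J\<close> of the sets \<open>{I. I \<subseteq> J}\<close> form a common eigenbasis of all
  matrices \<open>union_matrix p\<close>, with eigenvalues \<open>lam J = (\<Sum>K\<in>Pow J. p K)\<close>. Hence the principal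
  logarithm acts on \<open>zeta_vec J\<close> by \<open>ln (lam J)\<close>, and its parameter vector is the Moebius inverse
  of \<open>J \<mapsto> ln (lam J)\<close>. Since \<open>avoid p K = lam (- K)\<close>, the partition formula for \<open>r\<close>
  reduces to the fact that \<open>(-1) ^ card \<A> * fact (card \<A>)\<close> sums to \<open>(-1) ^ card X\<close> over the
  partitions \<open>\<A>\<close> of \<open>X\<close>. Any logarithm commutes with \<open>M\<close> and so preserves its eigenspaces. A
  principal logarithm is scalar on each of them; if the eigenspaces are lines, every real logarithm
  is scalar on them with a real eigenvalue. In both cases it is determined by \<open>M\<close>.
\<close>

section \<open>Alternating sums over set partitions\<close>

text \<open>Double counting: removing a distinguished block \<open>A\<close> from a partition of
  \<open>X\<close> is a bijection onto the pairs of a non-empty subset \<open>A\<close> and a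
  partition of \<open>X - A\<close>.\<close>

lemma sum_partition_on_block:
  fixes g :: "'a set \<Rightarrow> 'a set set \<Rightarrow> 'b::comm_monoid_add"
  assumes "finite X"
  shows "(\<Sum>\<A> | partition_on X \<A>. \<Sum>A\<in>\<A>. g A (\<A> - {A})) =
    (\<Sum>A\<in>Pow X - {{}}. \<Sum>\<B> | partition_on (X - A) \<B>. g A \<B>)"
proof -
  have fin: "finite \<A>" if "partition_on Y \<A>" "Y \<subseteq> X" for \<A> Y
    using that assms finite_elements finite_subset by metis
  have disj: "disjnt A (\<Union>(\<A> - {A}))" if "partition_on X \<A>" "A \<in> \<A>" for A \<A>
    using that by (auto simp: partition_on_def disjoint_def disjnt_def)
  have part: "partition_on (X - A) (\<A> - {A}) \<and> A \<subseteq> X \<and> A \<noteq> {}"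
    if "partition_on X \<A>" "A \<in> \<A>" for A \<A>
    using partition_on_insert[OF disj[OF that]] that by (simp add: insert_absorb)
  have part': "partition_on X (insert A \<B>)"
    if "partition_on (X - A) \<B>" "A \<subseteq> X" "A \<noteq> {}" for A \<B>
  proof -
    have "disjnt A (\<Union>\<B>)"
      using partition_onD1[OF that(1)] by (auto simp: disjnt_def)
    then show ?thesis
      using partition_on_insert that by blast
  qed
  have notin: "A \<notin> \<B>" if "partition_on (X - A) \<B>" "x \<in> A" for A \<B> x
    using that unfolding partition_on_def by blast
  have "(\<Sum>\<A> | partition_on X \<A>. \<Sum>A\<in>\<A>. g A (\<A> - {A})) =
    (\<Sum>(\<A>, A)\<in>(SIGMA \<A>:{\<A>. partition_on X \<A>}. \<A>). g A (\<A> - {A}))"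
    using assms fin by (intro sum.Sigma) (auto intro: finitely_many_partition_on)
  also have "\<dots> = (\<Sum>(A, \<B>)\<in>(SIGMA A:Pow X - {{}}. {\<B>. partition_on (X - A) \<B>}). g A \<B>)"
    by (rule sum.reindex_bij_witness[of _ "\<lambda>(A, \<B>). (insert A \<B>, A)" "\<lambda>(\<A>, A). (A, \<A> - {A})"])
       (use part part' notin in \<open>auto simp: insert_absorb\<close>)
  also have "\<dots> = (\<Sum>A\<in>Pow X - {{}}. \<Sum>\<B> | partition_on (X - A) \<B>. g A \<B>)"
    using assms by (intro sum.Sigma[symmetric]) (auto intro: finitely_many_partition_on)
  finally show ?thesis .
qed

lemma sum_Pow_diff:
  "(\<Sum>A\<in>Pow X - {{}}. f (X - A)) = (\<Sum>J\<in>Pow X - {X}. f J)"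
  by (rule sum.reindex_bij_witness[of _ "\<lambda>J. X - J" "\<lambda>A. X - A"])
     (auto simp: double_diff)

lemma sum_Pow_minus_one_card:
  assumes "finite X" "X \<noteq> {}"
  shows "(\<Sum>J\<in>Pow X. (-1) ^ card J) = (0::'a::ring_1)"
  using card_subsupersets_even_odd[of X "{}"] assms
  by (intro sum_alternating_cancels) auto

lemma sum_proper_subsets_minus_one_card:
  assumes "finite X" "X \<noteq> {}"
  shows "(\<Sum>J\<in>Pow X - {X}. (-1) ^ card J) = - ((-1) ^ card X :: 'a::ring_1)"
  using sum_Pow_minus_one_card[OF assms, where 'a = 'a] assms
  by (simp add: sum_diff1)

text \<open>Distinguishing one block absorbs the factor \<open>card \<A>\<close> of the factorial,
  which gives a recursion over proper subsets. In terms of exponential generating functions, this is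
  the expansion of exp(-x) = 1 / (1 + (exp(x) - 1)) in powers of exp(x) - 1.\<close>

lemma sum_partitions_fact:
  assumes "finite X"
  shows "(\<Sum>\<A> | partition_on X \<A>. (-1) ^ card \<A> * fact (card \<A>)) = ((-1) ^ card X :: real)"
  using assms
proof (induction X rule: finite_psubset_induct)
  case (psubset X)
  show ?case
  proof (cases "X = {}")
    case True
    then show ?thesis by (simp add: partition_on_empty)
  next
    case False
    have "(\<Sum>\<A> | partition_on X \<A>. (-1) ^ card \<A> * fact (card \<A>)) =
      (\<Sum>\<A> | partition_on X \<A>. \<Sum>A\<in>\<A>. - ((-1) ^ card (\<A> - {A}) * fact (card (\<A> - {A})) :: real))"
    proof (rule sum.cong[OF refl], clarify)
      fix \<A> assume P: "partition_on X \<A>"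
      then have "finite \<A>" "\<A> \<noteq> {}"
        using psubset.hyps False finite_elements[of X \<A>] by (auto simp: partition_on_def)
      \<comment> \<open>The inner sum has \<open>Suc k\<close> equal terms, and
        \<open>Suc k * fact k = fact (Suc k)\<close>.\<close>
      then obtain k where k: "card \<A> = Suc k"
        by (metis card_eq_0_iff not0_implies_Suc)
      then show "(-1) ^ card \<A> * fact (card \<A>) =
        (\<Sum>A\<in>\<A>. - ((-1) ^ card (\<A> - {A}) * fact (card (\<A> - {A})) :: real))"
        by (simp add: card_Diff_singleton)
    qed
    also have "\<dots> = (\<Sum>A\<in>Pow X - {{}}. \<Sum>\<B> | partition_on (X - A) \<B>. - ((-1) ^ card \<B> * fact (card \<B>)))"
      using sum_partition_on_block[of X "\<lambda>A \<B>. - ((-1) ^ card \<B> * fact (card \<B>) :: real)"] psubset.hyps by simp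
    also have "\<dots> = (\<Sum>A\<in>Pow X - {{}}. - ((-1) ^ card (X - A)))"
      by (rule sum.cong[OF refl], subst sum_negf, subst psubset.IH) auto
    also have "\<dots> = (-1) ^ card X"
      using sum_Pow_diff[of "\<lambda>J. - ((-1) ^ card J :: real)" X]
        sum_proper_subsets_minus_one_card[OF psubset.hyps False, where 'a = real]
      by (simp add: sum_negf)
    finally show ?thesis .
  qed
qed

text \<open>The weight of \<open>\<A>\<close> depends only on what is left after removing one block.
  With that block \<open>A\<close> distinguished, the partitions of \<open>X - A\<close> sum to a
  sign by \<open>sum_partitions_fact\<close>.\<close>

lemma sum_partitions_moebius:
  fixes h :: "'a set \<Rightarrow> real"
  assumes "finite X" "X \<noteq> {}"
  shows "(\<Sum>\<A> | partition_on X \<A>. (-1) ^ (card \<A> - 1) * fact (card \<A> - 1) * (\<Sum>A\<in>\<A>. h (X - A) - h X)) =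
    (\<Sum>J\<in>Pow X. (-1) ^ card J * h J)"
proof -
  have "(\<Sum>\<A> | partition_on X \<A>. (-1) ^ (card \<A> - 1) * fact (card \<A> - 1) * (\<Sum>A\<in>\<A>. h (X - A) - h X)) =
    (\<Sum>\<A> | partition_on X \<A>. \<Sum>A\<in>\<A>. (h (X - A) - h X) * ((-1) ^ card (\<A> - {A}) * fact (card (\<A> - {A}))))"
    using assms(1) by (auto intro!: sum.cong simp: sum_distrib_left card_Diff_singleton mult_ac)
  also have "\<dots> = (\<Sum>A\<in>Pow X - {{}}. \<Sum>\<B> | partition_on (X - A) \<B>.
      (h (X - A) - h X) * ((-1) ^ card \<B> * fact (card \<B>)))"
    using sum_partition_on_block[OF assms(1),
        of "\<lambda>A \<B>. (h (X - A) - h X) * ((-1) ^ card \<B> * fact (card \<B>))"] by simp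
  also have "\<dots> = (\<Sum>A\<in>Pow X - {{}}. (h (X - A) - h X) * (-1) ^ card (X - A))"
    using assms(1) by (simp flip: sum_distrib_left add: sum_partitions_fact)
  also have "\<dots> = (\<Sum>J\<in>Pow X - {X}. (h J - h X) * (-1) ^ card J)"
    by (rule sum_Pow_diff)
  \<comment> \<open>The last sum is \<open>- ((-1) ^ card X)\<close>, so the subtracted
    \<open>h X\<close> supplies exactly the missing term \<open>J = X\<close>.\<close>
  also have "\<dots> = (\<Sum>J\<in>Pow X - {X}. (-1) ^ card J * h J) - h X * (\<Sum>J\<in>Pow X - {X}. (-1) ^ card J)"
    by (simp add: algebra_simps sum_subtractf sum_distrib_left)
  also have "\<dots> = (\<Sum>J\<in>Pow X. (-1) ^ card J * h J)"
    unfolding sum_proper_subsets_minus_one_card[OF assms] using assms by (simp add: sum_diff1)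
  finally show ?thesis .
qed

section \<open>The matrix exponential and its action on vectors\<close>

text \<open>Matrix multiplication is bilinear in finite dimension, hence bounded by some constant
  \<open>c\<close>; the series is then dominated by that of \<open>exp (norm A * c)\<close>. The
  sort covers both the real and the complex case.\<close>

lemma mexp_sums:
  fixes A :: "'a::{real_normed_field,euclidean_space}^'m^'m"
  shows "(\<lambda>n. (1 / fact n) *\<^sub>R (((**) A ^^ n) (mat 1))) sums mexp A"
proof -
  have "bilinear ((**) :: 'a^'m^'m \<Rightarrow> 'a^'m^'m \<Rightarrow> 'a^'m^'m)"
    by (auto simp: bilinear_def linear_iff matrix_add_ldistrib matrix_matrix_mult_def
        vec_eq_iff sum.distrib algebra_simps scaleR_sum_right)
  then have "bounded_bilinear ((**) :: 'a^'m^'m \<Rightarrow> 'a^'m^'m \<Rightarrow> 'a^'m^'m)"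
    by (simp add: bilinear_conv_bounded_bilinear)
  from bounded_bilinear.pos_bounded[OF this]
  obtain c where c: "c > 0" "\<And>(B :: 'a^'m^'m) (C :: 'a^'m^'m). norm (B ** C) \<le> norm B * norm C * c"
    by blast
  have bound: "norm (((**) A ^^ n) (mat 1)) \<le> (norm A * c) ^ n * norm (mat 1 :: 'a^'m^'m)" for n
  proof (induction n)
    case (Suc n)
    have "norm (((**) A ^^ Suc n) (mat 1)) \<le> (norm A * c) * norm (((**) A ^^ n) (mat 1))"
      using c(2)[of A "((**) A ^^ n) (mat 1)"] by (simp add: mult_ac)
    also have "\<dots> \<le> (norm A * c) * ((norm A * c) ^ n * norm (mat 1 :: 'a^'m^'m))"
      using Suc c(1) by (intro mult_left_mono) auto
    finally show ?case by (simp add: mult_ac)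
  qed simp
  have "summable (\<lambda>n. norm ((1 / fact n) *\<^sub>R (((**) A ^^ n) (mat 1))))"
  proof (rule summable_comparison_test[OF exI, OF allI, OF impI])
    show "summable (\<lambda>n. (inverse (fact n) * (norm A * c) ^ n) * norm (mat 1 :: 'a^'m^'m))"
      by (intro summable_mult2 summable_exp)
    show "norm (norm ((1 / fact n) *\<^sub>R (((**) A ^^ n) (mat 1))))
      \<le> (inverse (fact n) * (norm A * c) ^ n) * norm (mat 1 :: 'a^'m^'m)" for n
      using bound[of n] by (simp add: field_simps)
  qed
  then show ?thesis
    unfolding mexp_def by (rule summable_sums[OF summable_norm_cancel])
qed

lemma linear_matrix_vector_left:
  fixes v :: "'a::real_normed_field^'m"
  shows "linear (\<lambda>A::'a^'m^'n. A *v v)"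
  by (auto simp: linear_iff matrix_vector_mult_def vec_eq_iff sum.distrib algebra_simps scaleR_sum_right)

lemma mexp_vector_sums:
  fixes A :: "'a::{real_normed_field,euclidean_space}^'m^'m"
  shows "(\<lambda>n. (1 / fact n) *\<^sub>R (((*v) A ^^ n) v)) sums (mexp A *v v)"
proof -
  have pow: "((**) A ^^ n) (mat 1) *v v = ((*v) A ^^ n) v" for n
    by (induction n) (simp_all flip: matrix_vector_mul_assoc)
  have bl: "bounded_linear (\<lambda>A::'a^'m^'m. A *v v)"
    using linear_matrix_vector_left linear_conv_bounded_linear by blast
  show ?thesis
    using bounded_linear.sums[OF bl mexp_sums[of A]]
    by (simp add: linear_cmul[OF linear_matrix_vector_left] pow)
qed

lemma bounded_linear_matrix_vector:
  fixes A :: "'a::{real_normed_field,euclidean_space}^'m^'n"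
  shows "bounded_linear ((*v) A)"
proof -
  have "linear ((*v) A)"
    by (auto simp: linear_iff matrix_vector_mult_def vec_eq_iff sum.distrib algebra_simps scaleR_sum_right)
  then show ?thesis
    using linear_conv_bounded_linear by blast
qed

text \<open>Makes every eigenspace of \<open>mexp A\<close> invariant under \<open>A\<close>. It
  holds because \<open>A\<close> commutes with each term of the series and acts
  continuously.\<close>

lemma mexp_commute:
  fixes A :: "'a::{real_normed_field,euclidean_space}^'m^'m"
  shows "mexp A *v (A *v v) = A *v (mexp A *v v)"
proof -
  have "(\<lambda>n. A *v ((1 / fact n) *\<^sub>R (((*v) A ^^ n) v))) sums (A *v (mexp A *v v))"
    by (rule bounded_linear.sums[OF bounded_linear_matrix_vector mexp_vector_sums])
  moreover have "A *v ((1 / fact n) *\<^sub>R (((*v) A ^^ n) v)) = (1 / fact n) *\<^sub>R (((*v) A ^^ n) (A *v v))" for n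
    by (simp add: linear_cmul[OF bounded_linear.linear[OF bounded_linear_matrix_vector]] funpow_swap1)
  ultimately show ?thesis
    using mexp_vector_sums[of A "A *v v"] sums_unique2 by (metis (no_types, lifting) sums_cong)
qed

text \<open>The vectors \<open>v\<close> and \<open>w\<close> form a Jordan chain of length two; the
  coefficient of \<open>w\<close> in the series is the derivative of the exponential series. Plain
  eigenvectors are the case \<open>w = 0\<close>.\<close>

lemma mexp_generalized_eigenvector:
  fixes A :: "'a::{real_normed_field,euclidean_space}^'m^'m"
  assumes v: "A *v v = \<mu> *s v + w" and w: "A *v w = \<mu> *s w"
  shows "mexp A *v v = exp \<mu> *s (v + w)"
proof -
  \<comment> \<open>At \<open>n = 0\<close> the exponent \<open>n - 1\<close> is truncated, but the
    factor \<open>of_nat n\<close> removes that term.\<close>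
  have powv: "((*v) A ^^ n) v = \<mu> ^ n *s v + (of_nat n * \<mu> ^ (n - 1)) *s w" for n
  proof (induction n)
    case (Suc n)
    have "((*v) A ^^ Suc n) v = \<mu> ^ n *s (\<mu> *s v + w) + (of_nat n * \<mu> ^ (n - 1)) *s (\<mu> *s w)"
      by (simp add: Suc vec.add vec.scale v w)
    then show ?case
      by (cases n) (simp_all add: vec_eq_iff algebra_simps)
  qed simp
  have e: "(\<lambda>n. (1 / fact n) *\<^sub>R \<mu> ^ n) sums exp \<mu>"
    using exp_converges[of \<mu>] by (simp add: divide_inverse)
  have "(\<lambda>n. (1 / fact (Suc n)) *\<^sub>R (of_nat (Suc n) * \<mu> ^ n)) = (\<lambda>n. (1 / fact n) *\<^sub>R \<mu> ^ n)"
    by (rule ext) (simp add: scaleR_conv_of_real field_simps del: of_nat_Suc)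
  then have "(\<lambda>n. (1 / fact (Suc n)) *\<^sub>R (of_nat (Suc n) * \<mu> ^ (Suc n - 1))) sums exp \<mu>"
    using e by simp
  then have e': "(\<lambda>n. (1 / fact n) *\<^sub>R (of_nat n * \<mu> ^ (n - 1))) sums exp \<mu>"
    by (subst (asm) sums_Suc_iff) simp
  have bl: "bounded_linear (\<lambda>c::'a. c *s u)" for u :: "'a^'m"
    unfolding linear_conv_bounded_linear[symmetric]
    by (auto simp: linear_iff vec_eq_iff algebra_simps)
  have "(\<lambda>n. ((1 / fact n) *\<^sub>R \<mu> ^ n) *s v + ((1 / fact n) *\<^sub>R (of_nat n * \<mu> ^ (n - 1))) *s w)
      sums (exp \<mu> *s v + exp \<mu> *s w)"
    by (intro sums_add bounded_linear.sums[OF bl] e e')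
  moreover have "((1 / fact n) *\<^sub>R \<mu> ^ n) *s v + ((1 / fact n) *\<^sub>R (of_nat n * \<mu> ^ (n - 1))) *s w
      = (1 / fact n) *\<^sub>R (((*v) A ^^ n) v)" for n
    unfolding powv by (simp add: vec_eq_iff algebra_simps)
  ultimately show ?thesis
    using mexp_vector_sums[of A v] sums_unique2 by (simp add: vec.scale_right_distrib)
qed

lemma mexp_eigenvector:
  fixes A :: "'a::{real_normed_field,euclidean_space}^'m^'m"
  assumes "A *v v = \<mu> *s v"
  shows "mexp A *v v = exp \<mu> *s v"
  using mexp_generalized_eigenvector[of A v \<mu> 0] assms by simp

section \<open>Annihilating polynomials and eigenvectors of the exponential\<close>

text \<open>There are \<open>CARD('m) + 1\<close> vectors in dimension \<open>CARD('m)\<close>. A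
  repeated vector is treated separately, since linear dependence is a notion for sets and not for
  families.\<close>

lemma ex_annihilating_combination:
  fixes u :: "nat \<Rightarrow> 'a::field^'m"
  shows "\<exists>a n. (\<exists>i\<le>n. a i \<noteq> 0) \<and> (\<Sum>i\<le>n. a i *s u i) = 0"
proof -
  define n where "n = CARD('m)"
  show ?thesis
  proof (cases "inj_on u {..n}")
    case False
    then obtain i j where ij: "i \<le> n" "j \<le> n" "i \<noteq> j" "u i = u j"
      by (auto simp: inj_on_def)
    define a :: "nat \<Rightarrow> 'a" where "a k = (if k = i then 1 else if k = j then - 1 else 0)" for k
    have "(\<Sum>k\<le>n. a k *s u k) = (\<Sum>k\<in>{i, j}. a k *s u k)"
      using ij by (intro sum.mono_neutral_right) (auto simp: a_def)
    then have "(\<Sum>k\<le>n. a k *s u k) = 0"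
      using ij by (simp add: a_def)
    moreover have "a i \<noteq> 0"
      by (simp add: a_def)
    ultimately show ?thesis
      using ij(1) by blast
  next
    case True
    have "vec.dependent (u ` {..n})"
    proof (rule vec.dependent_biggerset_general)
      have "vec.dim (u ` {..n}) \<le> CARD('m)"
        using vec.dim_subset[OF subset_UNIV, of "u ` {..n}"] unfolding vec_dim_card .
      then show "vec.dim (u ` {..n}) < card (u ` {..n})"
        using True by (simp add: card_image n_def)
    qed
    then obtain c where c: "\<exists>v\<in>u ` {..n}. c v \<noteq> 0" "(\<Sum>v\<in>u ` {..n}. c v *s v) = 0"
      using vec.dependent_finite[of "u ` {..n}"] by auto
    then have "(\<Sum>i\<le>n. c (u i) *s u i) = 0"
      using True by (simp add: sum.reindex)
    then show ?thesis
      using c(1) by (intro exI[of _ "\<lambda>i. c (u i)"] exI[of _ n]) auto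
  qed
qed

lemma ex_annihilating_poly:
  fixes X :: "'a::field^'m^'m" and v :: "'a^'m"
  shows "\<exists>q n. q \<noteq> 0 \<and> degree q \<le> n \<and> (\<Sum>i\<le>n. coeff q i *s (((*v) X ^^ i) v)) = 0"
proof -
  obtain a n where a: "\<exists>i\<le>n. a i \<noteq> 0" "(\<Sum>i\<le>n. a i *s (((*v) X ^^ i) v)) = 0"
    using ex_annihilating_combination[of "\<lambda>i. ((*v) X ^^ i) v"] by auto
  define q where "q = (\<Sum>i\<le>n. monom (a i) i)"
  have q: "coeff q i = (if i \<le> n then a i else 0)" for i
    by (simp add: q_def coeff_sum)
  have "q \<noteq> 0"
    using a(1) q by (metis coeff_0)
  moreover have "degree q \<le> n"
    by (rule degree_le) (simp add: q)
  moreover have "(\<Sum>i\<le>n. coeff q i *s (((*v) X ^^ i) v)) = 0"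
    using a(2) by (simp add: q)
  ultimately show ?thesis by blast
qed

text \<open>A linear factor of the polynomial in \<open>X\<close> is moved onto the vector. The
  bound drops by one, which drives the induction that peels off roots.\<close>

lemma poly_root_factor_apply:
  fixes X :: "'a::field^'m^'m" and v :: "'a^'m"
  assumes "degree q \<le> n"
  shows "(\<Sum>i\<le>Suc n. coeff ([:- z, 1:] * q) i *s (((*v) X ^^ i) v)) =
    (\<Sum>i\<le>n. coeff q i *s (((*v) X ^^ i) (X *v v - z *s v)))"
proof -
  have pow: "((*v) X ^^ i) (X *v v - z *s v) = ((*v) X ^^ Suc i) v - z *s ((*v) X ^^ i) v" for i
    by (induction i) (simp_all add: vec.diff vec.scale)
  have "coeff q (Suc n) = 0"
    using assms by (simp add: coeff_eq_0)
  then have z: "(\<Sum>i\<le>Suc n. (z * coeff q i) *s ((*v) X ^^ i) v) = (\<Sum>i\<le>n. (z * coeff q i) *s ((*v) X ^^ i) v)"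
    by simp
  have "(\<Sum>i\<le>Suc n. coeff ([:- z, 1:] * q) i *s (((*v) X ^^ i) v)) =
    (\<Sum>i\<le>Suc n. coeff (pCons 0 q) i *s ((*v) X ^^ i) v) - (\<Sum>i\<le>Suc n. (z * coeff q i) *s ((*v) X ^^ i) v)"
    by (simp only: sum_subtractf[symmetric]) (rule sum.cong, auto simp: vec_eq_iff algebra_simps)
  also have "(\<Sum>i\<le>Suc n. coeff (pCons 0 q) i *s ((*v) X ^^ i) v) = (\<Sum>i\<le>n. coeff q i *s ((*v) X ^^ Suc i) v)"
    by (subst sum.atMost_Suc_shift) simp
  finally show ?thesis
    unfolding z pow by (simp add: sum_subtractf[symmetric] vec.scale_right_diff_distrib mult.commute)
qed

text \<open>On an eigenspace of \<open>mexp X\<close>, the eigenvalues of \<open>X\<close> are confined to a single value \<open>l\<close> and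
  Jordan blocks of size two are impossible, because \<open>mexp X\<close> would inherit them.\<close>

lemma eigenvector_of_mexp_eigenvector:
  fixes X :: "complex^'m^'m"
  assumes l: "exp l = \<kappa>"
    and unique: "\<And>\<mu>. \<mu> \<in> spectrum X \<Longrightarrow> exp \<mu> = \<kappa> \<Longrightarrow> \<mu> = l"
    and v: "mexp X *v v = \<kappa> *s v"
  shows "X *v v = l *s v"
proof -
  have nz: "\<kappa> \<noteq> 0"
    using l by auto
  have inv: "mexp X *v (X *v w - z *s w) = \<kappa> *s (X *v w - z *s w)" if "mexp X *v w = \<kappa> *s w" for w z
    by (simp only: vec.diff vec.scale mexp_commute that vec.scale_right_diff_distrib vec.scale_left_commute)
  \<comment> \<open>An eigenvalue \<open>z\<close> of \<open>X\<close> inside the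
    \<open>\<kappa>\<close>-eigenspace satisfies \<open>exp z = \<kappa>\<close>, so
    \<open>unique\<close> applies.\<close>
  have eig: "w = 0 \<or> z = l" if "X *v w = z *s w" "mexp X *v w = \<kappa> *s w" for w z
  proof (rule disjCI)
    assume "z \<noteq> l"
    have "exp z *s w = \<kappa> *s w"
      using mexp_eigenvector[OF that(1)] that(2) by metis
    moreover have "z \<in> spectrum X" if "w \<noteq> 0"
      using that \<open>X *v w = z *s w\<close> by (auto simp: spectrum_def)
    ultimately show "w = 0"
      using unique \<open>z \<noteq> l\<close> vec.scale_cancel_right by blast
  qed
  \<comment> \<open>For \<open>z = l\<close>, a nonzero \<open>X *v w - l *s w\<close> would give a
    Jordan chain that \<open>mexp X\<close> inherits. Otherwise the factors \<open>X - l\<close> and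
    \<open>X - z\<close> commute, so \<open>X *v w - l *s w\<close> satisfies the eigenvector
    equation for \<open>z\<close> and vanishes by \<open>eig\<close>.\<close>
  have step: "X *v w = l *s w"
    if w: "mexp X *v w = \<kappa> *s w" and u: "X *v (X *v w - z *s w) = l *s (X *v w - z *s w)" for w z
  proof (cases "z = l")
    case True
    have "mexp X *v w = exp l *s (w + (X *v w - l *s w))"
      by (rule mexp_generalized_eigenvector) (use u True in auto)
    then have "\<kappa> *s w = \<kappa> *s w + \<kappa> *s (X *v w - l *s w)"
      by (simp only: w l vec.scale_right_distrib)
    then have "\<kappa> *s (X *v w - l *s w) = 0"
      by (metis add_cancel_left_right)
    then show ?thesis
      using nz by (metis eq_iff_diff_eq_0 vec.scale_eq_0_iff)
  next
    case False
    have "X *v (X *v w) = z *s (X *v w) + (l *s (X *v w) - l *s (z *s w))"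
      using u by (simp only: vec.diff vec.scale vec.scale_right_diff_distrib diff_eq_eq add.commute)
    then have "X *v (X *v w - l *s w) = z *s (X *v w - l *s w)"
      by (simp only: vec.diff vec.scale) (simp add: vec_eq_iff algebra_simps)
    with eig[OF _ inv[OF w]] False have "X *v w - l *s w = 0"
      by blast
    then show ?thesis by simp
  qed
  \<comment> \<open>Induction on the degree bound of a polynomial annihilating \<open>w\<close>:
    with a root \<open>z\<close> split off, the quotient annihilates \<open>X *v w - z *s w\<close>,
    and \<open>step\<close> returns to \<open>w\<close>.\<close>
  have "X *v w = l *s w"
    if "q \<noteq> 0" "degree q \<le> n" "(\<Sum>i\<le>n. coeff q i *s (((*v) X ^^ i) w)) = 0" "mexp X *v w = \<kappa> *s w"
    for q n w
    using that
  proof (induction n arbitrary: q w)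
    case 0
    then have "coeff q 0 \<noteq> 0"
      by (metis le_zero_eq leading_coeff_0_iff)
    with 0 have "w = 0"
      by (simp add: vec.scale_eq_0_iff)
    then show ?case by simp
  next
    case (Suc n)
    show ?case
    proof (cases "degree q \<le> n")
      case True
      then have "coeff q (Suc n) = 0"
        by (simp add: coeff_eq_0)
      with Suc.prems(3) have "(\<Sum>i\<le>n. coeff q i *s (((*v) X ^^ i) w)) = 0"
        by (simp only: sum.atMost_Suc vec.scale_zero_left add_0_right)
      with Suc.IH Suc.prems(1,4) True show ?thesis
        by blast
    next
      case False
      then have "\<not> constant (poly q)"
        by (simp add: constant_degree)
      then obtain z where "poly q z = 0"
        using fundamental_theorem_of_algebra by blast
      then obtain q' where q': "q = [:- z, 1:] * q'"
        by (auto simp: poly_eq_0_iff_dvd)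
      have "q' \<noteq> 0"
        using q' Suc.prems(1) by auto
      have "degree q = Suc (degree q')"
        unfolding q' using \<open>q' \<noteq> 0\<close> by (simp add: degree_mult_eq del: mult_pCons_left)
      then have deg: "degree q' \<le> n"
        using Suc.prems(2) by simp
      have "(\<Sum>i\<le>n. coeff q' i *s (((*v) X ^^ i) (X *v w - z *s w))) = 0"
        using Suc.prems(3) poly_root_factor_apply[OF deg, of z X w] unfolding q' by argo
      then have "X *v (X *v w - z *s w) = l *s (X *v w - z *s w)"
        using Suc.IH \<open>q' \<noteq> 0\<close> deg inv[OF Suc.prems(4)] by blast
      then show ?thesis
        using step Suc.prems(4) by blast
    qed
  qed
  then show ?thesis
    using ex_annihilating_poly[of X v] v by blast
qed

section \<open>The zeta basis\<close>

text \<open>These are the columns of the zeta matrix of the subset lattice. The field is left open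
  so that they serve real matrices and their complexifications alike.\<close>

definition zeta_vec :: "'n::finite set \<Rightarrow> 'a::field^('n set)" where
  "zeta_vec J = (\<chi> I. of_bool (I \<subseteq> J))"

text \<open>Applied to \<open>zeta_vec J\<close>, a matrix returns its row sums over the subsets of
  \<open>J\<close>; strong induction on \<open>J\<close> isolates the single entries.\<close>

lemma matrix_eq_zeta_vecI:
  fixes A B :: "'a::field^('n::finite set)^'m"
  assumes "\<And>J. A *v zeta_vec J = B *v zeta_vec J"
  shows "A = B"
proof -
  have "A $ i $ J = B $ i $ J" for i J
  proof (induction J rule: finite_psubset_induct[OF finite])
    case (1 J)
    have app: "(C *v zeta_vec J) $ i = C $ i $ J + (\<Sum>I\<in>Pow J - {J}. C $ i $ I)"
      for C :: "'a^('n set)^'m"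
    proof -
      have "(C *v zeta_vec J) $ i = (\<Sum>I\<in>Pow J. C $ i $ I)"
        by (simp add: matrix_vector_mult_def zeta_vec_def Pow_def sum.If_cases of_bool_def if_distrib cong: if_cong)
      then show ?thesis
        by (simp add: sum.remove)
    qed
    have "(\<Sum>I\<in>Pow J - {J}. A $ i $ I) = (\<Sum>I\<in>Pow J - {J}. B $ i $ I)"
      by (rule sum.cong[OF refl]) (use 1 in auto)
    with assms[of J] app[of A] app[of B] show ?case
      by (metis add_right_cancel)
  qed
  then show ?thesis
    by (simp add: vec_eq_iff)
qed

text \<open>The zeta matrix is unitriangular: coordinate \<open>J\<close> sees only the coefficients
  of supersets of \<open>J\<close>, so induction runs downwards from the full set.\<close>

lemma zeta_vec_independent:
  fixes c :: "'n::finite set \<Rightarrow> 'a::field"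
  assumes "(\<Sum>J\<in>UNIV. c J *s zeta_vec J) = (0 :: 'a^('n set))"
  shows "c J = 0"
proof (induction J rule: measure_induct_rule[of "\<lambda>J. card (- J)"])
  case (less J)
  have "0 = (\<Sum>K\<in>UNIV. c K *s zeta_vec K) $ J"
    by (simp add: assms)
  also have "\<dots> = (\<Sum>K\<in>UNIV. if K = J then c J else 0)"
    unfolding sum_component
  proof (rule sum.cong[OF refl])
    fix K
    show "(c K *s zeta_vec K) $ J = (if K = J then c J else 0)"
    proof (cases "J \<subset> K")
      case True
      then have "c K = 0"
        by (intro less psubset_card_mono) auto
      with True show ?thesis by auto
    qed (auto simp: zeta_vec_def)
  qed
  finally show ?case by simp
qed

text \<open>By independence the square matrix with columns \<open>zeta_vec J\<close> has trivial
  kernel, so it is invertible.\<close>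

lemma zeta_vec_span:
  fixes v :: "'a::field^('n::finite set)"
  shows "\<exists>c. v = (\<Sum>J\<in>UNIV. c J *s zeta_vec J)"
proof -
  define C :: "'a^('n set)^('n set)" where "C = (\<chi> I J. zeta_vec J $ I)"
  have C: "C *v x = (\<Sum>J\<in>UNIV. x $ J *s zeta_vec J)" for x
    by (simp add: C_def vec_eq_iff matrix_vector_mult_def mult.commute)
  have "x = 0" if "C *v x = 0" for x
    using zeta_vec_independent[of "\<lambda>J. x $ J"] that by (simp add: C vec_eq_iff)
  then have "invertible C"
    using invertible_left_inverse matrix_left_invertible_ker by blast
  then obtain C' where "C ** C' = mat 1"
    unfolding invertible_def by blast
  then have "v = C *v (C' *v v)"
    by (simp add: matrix_vector_mul_assoc)
  then show ?thesis
    unfolding C by (rule exI[of _ "\<lambda>J. (C' *v v) $ J"])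
qed

lemma zeta_vec_nonzero: "zeta_vec J \<noteq> (0 :: 'a::field^('n::finite set))"
  by (auto simp: zeta_vec_def vec_eq_iff intro!: exI[of _ J])

lemma zeta_vec_eigen_coeff:
  fixes A :: "'a::field^('n::finite set)^('n set)"
  assumes "\<And>J. A *v zeta_vec J = \<mu> J *s zeta_vec J"
    and "A *v (\<Sum>J\<in>UNIV. c J *s zeta_vec J) = \<kappa> *s (\<Sum>J\<in>UNIV. c J *s zeta_vec J)"
  shows "c J = 0 \<or> \<mu> J = \<kappa>"
proof -
  have "A *v (\<Sum>J\<in>UNIV. c J *s zeta_vec J) = (\<Sum>J\<in>UNIV. (c J * \<mu> J) *s zeta_vec J)"
    by (simp add: vec.sum vec.scale assms(1))
  then have "(\<Sum>J\<in>UNIV. (c J * \<mu> J - \<kappa> * c J) *s zeta_vec J) = (0 :: 'a^('n set))"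
    using assms(2) by (simp add: vec.scale_left_diff_distrib sum_subtractf vec.scale_sum_right)
  from zeta_vec_independent[OF this] show ?thesis
    by (metis mult.commute right_minus_eq mult_cancel_right)
qed

lemma spectrum_zeta_vec:
  fixes A :: "'a::field^('n::finite set)^('n set)"
  assumes "\<And>J. A *v zeta_vec J = \<mu> J *s zeta_vec J"
  shows "spectrum A = range \<mu>"
proof
  show "spectrum A \<subseteq> range \<mu>"
  proof
    fix \<kappa> assume "\<kappa> \<in> spectrum A"
    then obtain v where v: "v \<noteq> 0" "A *v v = \<kappa> *s v"
      by (auto simp: spectrum_def)
    obtain c where c: "v = (\<Sum>J\<in>UNIV. c J *s zeta_vec J)"
      using zeta_vec_span by blast
    then obtain J where "c J \<noteq> 0"
      using v(1) by (metis (no_types, lifting) sum.neutral vec.scale_zero_left)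
    then have "\<mu> J = \<kappa>"
      using zeta_vec_eigen_coeff[OF assms] v(2) c by blast
    then show "\<kappa> \<in> range \<mu>"
      by auto
  qed
  show "range \<mu> \<subseteq> spectrum A"
    using assms zeta_vec_nonzero by (auto simp: spectrum_def)
qed

lemma zeta_vec_simple_eigenspace:
  fixes A :: "'a::field^('n::finite set)^('n set)"
  assumes "\<And>J. A *v zeta_vec J = \<mu> J *s zeta_vec J" and "inj \<mu>" and "A *v v = \<mu> J *s v"
  shows "\<exists>a. v = a *s zeta_vec J"
proof -
  obtain c where c: "v = (\<Sum>J\<in>UNIV. c J *s zeta_vec J)"
    using zeta_vec_span by blast
  have "c K = 0" if "K \<noteq> J" for K
    using zeta_vec_eigen_coeff[OF assms(1), of c "\<mu> J" K] assms(2,3) that c by (auto dest: injD)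
  then have "v = (\<Sum>K\<in>UNIV. if K = J then c J *s zeta_vec J else 0)"
    unfolding c by (intro sum.cong) auto
  then show ?thesis by auto
qed

section \<open>Matrices given by a parameter vector\<close>

text \<open>Row \<open>I\<close> sums \<open>p K\<close> over all \<open>K\<close> with
  \<open>I \<union> K \<subseteq> J\<close>, and this condition splits into
  \<open>I \<subseteq> J\<close> and \<open>K \<subseteq> J\<close>.\<close>

lemma union_matrix_zeta_vec:
  "union_matrix p *v zeta_vec J = (\<Sum>K\<in>Pow J. p K) *s zeta_vec J"
proof -
  have "(union_matrix p *v zeta_vec J) $ I = ((\<Sum>K\<in>Pow J. p K) *s zeta_vec J) $ I" for I
  proof -
    have "(union_matrix p *v zeta_vec J) $ I =
      (\<Sum>L\<in>UNIV. \<Sum>K | K \<in> UNIV \<and> I \<union> K = L. p K * of_bool (L \<subseteq> J))"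
      by (simp add: matrix_vector_mult_def union_matrix_def zeta_vec_def sum_distrib_right)
    also have "\<dots> = (\<Sum>L\<in>UNIV. \<Sum>K | K \<in> UNIV \<and> I \<union> K = L. p K * of_bool (I \<union> K \<subseteq> J))"
      by (auto intro!: sum.cong)
    also have "\<dots> = (\<Sum>K\<in>UNIV. p K * of_bool (I \<union> K \<subseteq> J))"
      by (rule sum.group) auto
    also have "\<dots> = (\<Sum>K\<in>Pow J. p K) * of_bool (I \<subseteq> J)"
      by (auto simp: sum_distrib_right Pow_def intro!: sum.mono_neutral_cong_right)
    finally show ?thesis
      by (simp add: zeta_vec_def)
  qed
  then show ?thesis
    by (simp add: vec_eq_iff)
qed

lemma cmat_zeta_vec:
  assumes "A *v zeta_vec J = \<mu> *s zeta_vec J"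
  shows "cmat A *v zeta_vec J = complex_of_real \<mu> *s zeta_vec J"
proof -
  have "(cmat A *v zeta_vec J) $ i = complex_of_real ((A *v zeta_vec J) $ i)" for i
    by (simp add: matrix_vector_mult_def zeta_vec_def)
  then show ?thesis
    unfolding assms by (simp add: vec_eq_iff zeta_vec_def)
qed

lemma union_matrix_row_sum: "(\<Sum>J\<in>UNIV. union_matrix p $ I $ J) = (\<Sum>K\<in>UNIV. p K)"
  using sum.group[of UNIV UNIV "\<lambda>K. I \<union> K" p] by (simp add: union_matrix_def)

lemma union_matrix_triangular: "\<not> I \<subseteq> J \<Longrightarrow> union_matrix p $ I $ J = 0"
  by (auto simp: union_matrix_def intro!: sum.neutral)

text \<open>The row of the empty set lists the parameters themselves. Conversely,
  \<open>p {}\<close> of any parameter vector \<open>p\<close> enters only diagonal entries, because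
  \<open>I \<union> {} = I\<close>.\<close>

lemma union_matrix_markov_generator_iff:
  assumes "(\<Sum>K\<in>UNIV. r K) = 0"
  shows "markov_generator (union_matrix r) \<longleftrightarrow> (\<forall>K. K \<noteq> {} \<longrightarrow> 0 \<le> r K)"
proof
  assume "markov_generator (union_matrix r)"
  then have "0 \<le> union_matrix r $ {} $ K" if "K \<noteq> {}" for K
    using that by (auto simp: markov_generator_def)
  then show "\<forall>K. K \<noteq> {} \<longrightarrow> 0 \<le> r K"
    by (simp add: union_matrix_def)
next
  assume "\<forall>K. K \<noteq> {} \<longrightarrow> 0 \<le> r K"
  then show "markov_generator (union_matrix r)"
    using assms unfolding markov_generator_def zero_row_sums_def union_matrix_row_sum
    by (auto simp: union_matrix_def intro!: sum_nonneg)
qed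

text \<open>Moebius inversion on the subset lattice, with the sign of \<open>K - J\<close> split
  into those of \<open>K\<close> and \<open>J\<close>.\<close>

lemma sum_Pow_moebius:
  fixes h :: "'a set \<Rightarrow> 'b::comm_ring_1"
  assumes "finite X"
  shows "(\<Sum>K\<in>Pow X. (-1) ^ card K * (\<Sum>J\<in>Pow K. (-1) ^ card J * h J)) = h X"
  using inclusion_exclusion_symmetric[of "\<lambda>K. \<Sum>J\<in>Pow K. (-1) ^ card J * h J" h X] assms by simp

text \<open>The real exponential is injective, so a real eigenvalue of a logarithm is determined by
  that of the exponential.\<close>

lemma eigenvector_exp_inj:
  fixes R :: "real^'m^'m"
  assumes "R *v v = \<rho> *s v" "mexp R *v v = exp \<mu> *s v" "v \<noteq> 0"
  shows "\<rho> = \<mu>"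
  using mexp_eigenvector[OF assms(1)] assms(2,3) by (simp add: vec.scale_cancel_right)

theorem theorem6p3:
  fixes M :: "real^('n::finite set)^('n set)" and p :: "'n set \<Rightarrow> real"
  assumes "CM_param p M"
  shows "(invertible M \<longleftrightarrow> 0 < p {}) \<and>
    (invertible M \<longrightarrow>
      (\<exists>R r.
        \<comment> \<open>(1)\<close>
        M = mexp R \<and>
        is_principal_log (cmat M) (cmat R) \<and>
        (\<forall>X. is_principal_log (cmat M) X \<longrightarrow> X = cmat R) \<and>
        \<comment> \<open>(2)\<close>
        (\<forall>I J. \<not> I \<subseteq> J \<longrightarrow> R $ I $ J = 0) \<and>
        zero_row_sums R \<and>
        spectrum (cmat R) \<subseteq> \<real> \<and>
        CG_param r R \<and>
        r {} = ln (p {}) \<and>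
        (\<forall>K. K \<noteq> {} \<longrightarrow>
          r K = (-1) ^ card K *
            (\<Sum>\<A> | partition_on K \<A>.
              (-1) ^ (card \<A> - 1) * fact (card \<A> - 1) * ln (part_avoid p (- K) \<A>))) \<and>
        \<comment> \<open>(3)\<close>
        (markov_generator R \<longleftrightarrow> (\<forall>K. K \<noteq> {} \<longrightarrow> 0 \<le> r K)) \<and>
        (markov_generator R \<longrightarrow> MCCP_embeddable M) \<and>
        \<comment> \<open>(4)\<close>
        (\<forall>R'. M = mexp R' \<and> CG_matrix R' \<longrightarrow> R' = R) \<and>
        \<comment> \<open>(5)\<close>
        (simple_spectrum (cmat M) \<longrightarrow>
          (\<forall>R'. M = mexp R' \<longrightarrow> R' = R) \<and>
          (embeddable M \<longleftrightarrow> markov_generator R))))"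
proof -
  define lam where "lam J = (\<Sum>K\<in>Pow J. p K)" for J
  define h where "h J = ln (lam J)" for J
  \<comment> \<open>Chosen so that the sum of \<open>r K\<close> over the subsets \<open>K\<close>
    of \<open>J\<close> is \<open>h J\<close>, the eigenvalue that \<open>R\<close> must have on
    \<open>zeta_vec J\<close>.\<close>
  define r where "r K = (-1) ^ card K * (\<Sum>J\<in>Pow K. (-1) ^ card J * h J)" for K
  define R :: "real^('n set)^('n set)" where "R = union_matrix r"
  have p: "\<And>K. 0 \<le> p K" "(\<Sum>K\<in>UNIV. p K) = 1" and M: "M = union_matrix p"
    using assms by (auto simp: CM_param_def)
  have lam_UNIV: "lam UNIV = 1"
    using p(2) by (simp add: lam_def)
  have lam_pos: "0 < lam J" if "0 < p {}" for J
  proof -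
    have "p {} \<le> lam J"
      unfolding lam_def by (rule member_le_sum) (use p(1) in auto)
    then show ?thesis
      using that by simp
  qed
  have M_zeta: "M *v zeta_vec J = lam J *s zeta_vec J" for J
    unfolding M lam_def by (rule union_matrix_zeta_vec)
  have inv: "invertible M \<longleftrightarrow> 0 < p {}"
  proof
    assume "invertible M"
    \<comment> \<open>The empty set gives the smallest eigenvalue, \<open>p {}\<close>.\<close>
    then have "M *v zeta_vec {} \<noteq> 0"
      using zeta_vec_nonzero by (metis invertible_left_inverse matrix_left_invertible_ker)
    then have "p {} \<noteq> 0"
      by (auto simp: M_zeta lam_def)
    then show "0 < p {}"
      using p(1)[of "{}"] by simp
  next
    assume "0 < p {}"
    then have "0 \<notin> spectrum M"
      using lam_pos by (auto simp: spectrum_zeta_vec[OF M_zeta]) (metis less_irrefl)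
    then have "\<forall>x. M *v x = 0 \<longrightarrow> x = 0"
      by (auto simp: spectrum_def)
    then show "invertible M"
      by (simp add: invertible_left_inverse matrix_left_invertible_ker)
  qed
  have R_zeta: "R *v zeta_vec J = h J *s zeta_vec J" for J
    unfolding R_def r_def by (subst union_matrix_zeta_vec) (simp add: sum_Pow_moebius)
  \<comment> \<open>The total is \<open>h UNIV = ln 1\<close>, because \<open>p\<close> is a
    probability vector.\<close>
  have r_sum: "(\<Sum>K\<in>UNIV. r K) = 0"
    using sum_Pow_moebius[of UNIV h] by (simp add: r_def h_def lam_UNIV)
  have CG: "CG_param r R"
    using r_sum by (simp add: CG_param_def R_def)
  show ?thesis
  proof (intro conjI impI inv exI[of _ R] exI[of _ r])
    assume "invertible M"
    then have pos: "\<And>J. 0 < lam J"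
      using inv lam_pos by blast
    have exp_h: "exp (h J) = lam J" for J
      by (simp add: h_def pos)
    have cexp_h: "exp (complex_of_real (h J)) = complex_of_real (lam J)" for J
      using exp_h by (metis exp_of_real)
    have eigenvector_log: "R' *v zeta_vec J = h J *s zeta_vec J"
      if "M = mexp R'" "R' *v zeta_vec J = \<rho> *s zeta_vec J" for R' J \<rho>
      using eigenvector_exp_inj[OF that(2)] that exp_h M_zeta zeta_vec_nonzero by metis
    show MR: "M = mexp R"
      by (rule matrix_eq_zeta_vecI) (simp add: mexp_eigenvector[OF R_zeta] exp_h M_zeta)
    have spec: "spectrum (cmat R) = range (\<lambda>J. complex_of_real (h J))"
      by (rule spectrum_zeta_vec, rule cmat_zeta_vec, rule R_zeta)
    then show "spectrum (cmat R) \<subseteq> \<real>"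
      by auto
    have "mexp (cmat R) = cmat M"
      by (rule matrix_eq_zeta_vecI)
        (simp add: mexp_eigenvector[OF cmat_zeta_vec[OF R_zeta]] cexp_h cmat_zeta_vec[OF M_zeta])
    then show "is_principal_log (cmat M) (cmat R)"
      by (auto simp: is_principal_log_def spec)
    show "\<forall>X. is_principal_log (cmat M) X \<longrightarrow> X = cmat R"
    proof (intro allI impI, rule matrix_eq_zeta_vecI)
      fix X J assume X: "is_principal_log (cmat M) X"
      have "X *v zeta_vec J = complex_of_real (h J) *s zeta_vec J"
      proof (rule eigenvector_of_mexp_eigenvector[OF cexp_h])
        show "mexp X *v zeta_vec J = complex_of_real (lam J) *s zeta_vec J"
          using X cmat_zeta_vec[OF M_zeta] by (simp add: is_principal_log_def)
        fix \<mu> assume \<mu>: "\<mu> \<in> spectrum X" "exp \<mu> = complex_of_real (lam J)"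
        then have "- pi < Im \<mu>" "Im \<mu> < pi"
          using X unfolding is_principal_log_def by blast+
        \<comment> \<open>Since \<open>h J\<close> is real, both logarithms of \<open>lam J\<close>
          lie in the open strip, where the exponential is injective.\<close>
        then have "\<bar>Im \<mu> - Im (complex_of_real (h J))\<bar> < 2 * pi"
          by simp
        then show "\<mu> = complex_of_real (h J)"
          by (rule exp_complex_eqI) (simp add: cexp_h \<mu>(2))
      qed
      then show "X *v zeta_vec J = cmat R *v zeta_vec J"
        by (simp add: cmat_zeta_vec[OF R_zeta])
    qed
    show "\<forall>I J. \<not> I \<subseteq> J \<longrightarrow> R $ I $ J = 0"
      unfolding R_def using union_matrix_triangular by blast
    show "zero_row_sums R"
      unfolding zero_row_sums_def R_def union_matrix_row_sum by (simp add: r_sum)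
    show "CG_param r R"
      by (fact CG)
    show "r {} = ln (p {})"
      by (simp add: r_def h_def lam_def)
    show "\<forall>K. K \<noteq> {} \<longrightarrow> r K = (-1) ^ card K * (\<Sum>\<A> | partition_on K \<A>.
        (-1) ^ (card \<A> - 1) * fact (card \<A> - 1) * ln (part_avoid p (- K) \<A>))"
    proof (intro allI impI)
      fix K :: "'n set" assume "K \<noteq> {}"
      have avoid: "avoid p B = lam (- B)" for B
        by (simp add: avoid_def lam_def Pow_def)
      have nz: "lam J \<noteq> 0" for J
        using pos[of J] by simp
      \<comment> \<open>The complement of \<open>A \<union> - K\<close> is \<open>K - A\<close>, so
        \<open>cond_avoid p (- K) A\<close> equals \<open>lam (K - A) / lam K\<close>.\<close>
      have "ln (part_avoid p (- K) \<A>) = (\<Sum>A\<in>\<A>. h (K - A) - h K)" for \<A>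
      proof -
        have "ln (part_avoid p (- K) \<A>) = (\<Sum>A\<in>\<A>. ln (lam (K - A) / lam K))"
          unfolding part_avoid_def cond_avoid_def avoid
          by (subst ln_prod) (auto simp: nz Diff_eq Int_commute)
        then show ?thesis
          by (simp add: h_def ln_div nz)
      qed
      then show "r K = (-1) ^ card K * (\<Sum>\<A> | partition_on K \<A>.
          (-1) ^ (card \<A> - 1) * fact (card \<A> - 1) * ln (part_avoid p (- K) \<A>))"
        using sum_partitions_moebius[of K h] \<open>K \<noteq> {}\<close> by (simp add: r_def)
    qed
    show gen: "markov_generator R \<longleftrightarrow> (\<forall>K. K \<noteq> {} \<longrightarrow> 0 \<le> r K)"
      unfolding R_def by (rule union_matrix_markov_generator_iff[OF r_sum])
    show "markov_generator R \<Longrightarrow> MCCP_embeddable M"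
      using MR CG unfolding MCCP_embeddable_def CG_matrix_def by blast
    show "\<forall>R'. M = mexp R' \<and> CG_matrix R' \<longrightarrow> R' = R"
    proof (intro allI impI, rule matrix_eq_zeta_vecI)
      fix R' J assume R': "M = mexp R' \<and> CG_matrix R'"
      then obtain s where "R' = union_matrix s"
        by (auto simp: CG_matrix_def CG_param_def)
      \<comment> \<open>Having the form \<open>union_matrix s\<close>, the matrix \<open>R'\<close>
        has the zeta vectors as eigenvectors with real eigenvalues.\<close>
      then show "R' *v zeta_vec J = R *v zeta_vec J"
        using eigenvector_log union_matrix_zeta_vec R' R_zeta by metis
    qed
    assume "simple_spectrum (cmat M)"
    moreover have "spectrum (cmat M) = range (\<lambda>J. complex_of_real (lam J))"
      by (rule spectrum_zeta_vec, rule cmat_zeta_vec, rule M_zeta)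
    \<comment> \<open>There are as many distinct eigenvalues as subsets.\<close>
    ultimately have "inj (\<lambda>J. complex_of_real (lam J))"
      by (simp add: simple_spectrum_def eq_card_imp_inj_on)
    then have inj: "inj lam"
      by (auto simp: inj_on_def)
    show unique: "\<forall>R'. M = mexp R' \<longrightarrow> R' = R"
    proof (intro allI impI, rule matrix_eq_zeta_vecI)
      fix R' J assume R': "M = mexp R'"
      \<comment> \<open>The eigenspaces of \<open>M\<close> are now lines and \<open>R'\<close>
        preserves them, so each \<open>zeta_vec J\<close> is an eigenvector of
        \<open>R'\<close>.\<close>
      have "M *v (R' *v zeta_vec J) = lam J *s (R' *v zeta_vec J)"
        using mexp_commute[of R' "zeta_vec J"] M_zeta[of J] by (simp add: R' vec.scale)
      then show "R' *v zeta_vec J = R *v zeta_vec J"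
        using zeta_vec_simple_eigenspace[OF M_zeta inj] eigenvector_log[OF R'] R_zeta by metis
    qed
    show "embeddable M \<longleftrightarrow> markov_generator R"
      using unique MR unfolding embeddable_def by blast
  qed
qed

end
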